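(* Let $n\in\mathbb{N}$, $p\in[0,1]$, $q=1-p$, and let $\alpha=(\alpha_1,\dots,\alpha_n)\in[n]^n$ be a parking function whose classical outcome is the identity permutation (equivalently, $\alpha_i\le i$ for all $i\in[n]$). Put $d_i=i-\alpha_i$. In the probabilistic parking protocol under the unbounded model with preference list $\alpha$ and parameter $p$, the following hold. (1) If $1<i\le n$, then $$\Pr\Big[X_\alpha^i=1\;\Big|\;\prod_{j=1}^{i-1}X_\alpha^j=1\Big]=\sum_{\ell=0}^\infty \frac{d_i}{\ell+d_i}\binom{2\ell+d_i-1}{\ell}p^{d_i+\ell}q^\ell .$$ Moreover, $\Pr\big[X_\alpha^i=1\mid\prod_{j=1}^{i-1}X_\alpha^j=1\big]=1$ if and only if $1/2\le p\le 1$. (2) If $1<i\le n$ and $1/2<p\le 1$, then $$\mathbb{E}\Big[\tau_\alpha^i\;\Big|\;\prod_{j=1}^{i}X_\alpha^j=1\Big]=\frac{d_i}{p-q}.$$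
   Context: $[n]=\{1,\dots,n\}$. Classical parking: cars $1,\dots,n$ enter in order, car $i$ goes to its preferred spot $\alpha_i$ and parks in the first unoccupied spot among $\alpha_i,\alpha_i+1,\dots,n$, if any; $\alpha$ is a parking function if all cars park, and its outcome is the resulting order of the parked cars. The outcome is the identity permutation when car $i$ parks in spot $i$ for every $i$; this holds exactly when $\alpha_i\le i$ for all $i$. Then $d_i=i-\alpha_i$ is the displacement of car $i$ in the classical protocol. Probabilistic parking protocol, unbounded model: cars $1,2,\dots,n$ arrive one at a time in this order, and a car may enter only after its predecessor has completed its search. Car $i$ starts at spot $\alpha_i$ and parks there if it is unoccupied; otherwise it performs a nearest-neighbour random walk on $\mathbb{Z}$, each step being $+1$ with probability $p$ and $-1$ with probability $q=1-p$, and parks in the first unoccupied spot of $[n]$ it encounters, if any. Cars may drift anywhere in $\mathbb{Z}$ but can only park in $[n]$. If a car drifts off to infinity, it does not park and no later car is able to begin parking. $X_\alpha^i$ is the indicator random variable equal to $1$ if car $i$ parks and $0$ otherwise. For such $\alpha$, when cars $1,\dots,i-1$ have all parked they occupy spots $1,\dots,i-1$, and car $i$ parks if and only if it hits position $i$. $Z_t^i$ denotes the position of car $i$ at time $t$ (that is, after $t$ steps, with $Z_0^i=\alpha_i$), and $\tau_\alpha^i=\min\{t\ge 0: Z_t^i=i \text{ or } Z_t^i=\infty\}$.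
   Formalization: The "if and only if" in (1) is stated for d_i > 0, since for d_i = 0 the car always parks, also when p < 1/2; for d_i = 0 the ℓ = 0 term of the series (0/0) is read as 1 and the formula assumes the conditioning event has positive probability. *)

theory Defs
  imports "HOL-Probability.Probability"
begin

section \<open>Classical parking\<close>

text \<open>
  A preference list is a function \<open>\<alpha>\<close> on car numbers, only its values on \<open>{1..n}\<close> matter.
  The map \<open>classical_park n \<alpha> k\<close> sends each spot occupied after the turns of cars
  \<open>1, \<dots>, k\<close> to the car parked there.
\<close>

primrec classical_park :: "nat \<Rightarrow> (nat \<Rightarrow> nat) \<Rightarrow> nat \<Rightarrow> (nat \<rightharpoonup> nat)" where
  "classical_park n \<alpha> 0 = Map.empty"
| "classical_park n \<alpha> (Suc k) =
     (let occ = classical_park n \<alpha> k; free = {\<alpha> (Suc k)..n} - dom occ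
      in if free = {} then occ else occ(Min free \<mapsto> Suc k))"

definition classical_outcome :: "nat \<Rightarrow> (nat \<Rightarrow> nat) \<Rightarrow> (nat \<rightharpoonup> nat)" where
  "classical_outcome n \<alpha> = classical_park n \<alpha> n"

definition parking_function :: "nat \<Rightarrow> (nat \<Rightarrow> nat) \<Rightarrow> bool" where
  "parking_function n \<alpha> \<longleftrightarrow>
     \<alpha> \<in> {1..n} \<rightarrow> {1..n} \<and> (\<forall>i\<in>{1..n}. i \<in> ran (classical_outcome n \<alpha>))"

definition identity_outcome :: "nat \<Rightarrow> (nat \<Rightarrow> nat) \<Rightarrow> bool" where
  "identity_outcome n \<alpha> \<longleftrightarrow> (\<forall>s\<in>{1..n}. classical_outcome n \<alpha> s = Some s)"

text \<open>
  The subtraction is on natural numbers; it does not truncate when the classical outcome is the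
  identity, since then \<open>\<alpha> i \<le> i\<close>.
\<close>

definition displacement :: "(nat \<Rightarrow> nat) \<Rightarrow> nat \<Rightarrow> nat" where
  "displacement \<alpha> i = i - \<alpha> i"

section \<open>Probabilistic parking, unbounded model\<close>

text \<open>
  A sample point \<open>\<omega>\<close> assigns to each car \<open>i\<close> its step sequence: \<open>\<omega> i t\<close> says whether step
  \<open>t + 1\<close> of car \<open>i\<close> is \<open>+1\<close> (otherwise it is \<open>-1\<close>). All steps of all cars are independent. Steps
  that a car never makes (because it has parked or never enters) are simply not used.
\<close>

definition step_space :: "real \<Rightarrow> (nat \<Rightarrow> nat \<Rightarrow> bool) measure" where
  "step_space p =
     (\<Pi>\<^sub>M i\<in>(UNIV :: nat set). \<Pi>\<^sub>M t\<in>(UNIV :: nat set). measure_pmf (bernoulli_pmf p))"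

definition walk :: "nat \<Rightarrow> (nat \<Rightarrow> bool) \<Rightarrow> nat \<Rightarrow> int" where
  "walk a w t = int a + (\<Sum>s<t. if w s then 1 else - 1)"

definition reaches_free :: "nat \<Rightarrow> nat set \<Rightarrow> nat \<Rightarrow> (nat \<Rightarrow> bool) \<Rightarrow> nat \<Rightarrow> bool" where
  "reaches_free n occ a w t \<longleftrightarrow> walk a w t \<in> int ` ({1..n} - occ)"

text \<open>
  The spot where a car with preference \<open>a\<close> and steps \<open>w\<close> parks when the spots in \<open>occ\<close> are taken;
  time \<open>0\<close> covers the case that \<open>a\<close> itself is free.
\<close>

definition park_spot :: "nat \<Rightarrow> nat set \<Rightarrow> nat \<Rightarrow> (nat \<Rightarrow> bool) \<Rightarrow> nat option" where
  "park_spot n occ a w =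
     (if \<exists>t. reaches_free n occ a w t
      then Some (nat (walk a w (LEAST t. reaches_free n occ a w t)))
      else None)"

text \<open>
  The set of occupied spots once cars \<open>1, \<dots>, k\<close> have parked, or \<open>None\<close> if one of them never
  parks; in the latter case no later car begins parking.
\<close>

primrec occupied ::
  "nat \<Rightarrow> (nat \<Rightarrow> nat) \<Rightarrow> (nat \<Rightarrow> nat \<Rightarrow> bool) \<Rightarrow> nat \<Rightarrow> nat set option" where
  "occupied n \<alpha> \<omega> 0 = Some {}"
| "occupied n \<alpha> \<omega> (Suc k) =
     (case occupied n \<alpha> \<omega> k of
        None \<Rightarrow> None
      | Some occ \<Rightarrow> map_option (\<lambda>s. insert s occ) (park_spot n occ (\<alpha> (Suc k)) (\<omega> (Suc k))))"

definition X :: "nat \<Rightarrow> (nat \<Rightarrow> nat) \<Rightarrow> nat \<Rightarrow> (nat \<Rightarrow> nat \<Rightarrow> bool) \<Rightarrow> real" where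
  "X n \<alpha> i \<omega> = (if occupied n \<alpha> \<omega> i \<noteq> None then 1 else 0)"

text \<open>
  \<open>Z\<close> is the trajectory that car \<open>i\<close> follows until it parks, continued freely afterwards; this
  does not affect the first time it is at \<open>i\<close>.
\<close>

definition Z :: "(nat \<Rightarrow> nat) \<Rightarrow> nat \<Rightarrow> (nat \<Rightarrow> nat \<Rightarrow> bool) \<Rightarrow> nat \<Rightarrow> int" where
  "Z \<alpha> i \<omega> t = walk (\<alpha> i) (\<omega> i) t"

text \<open>
  The walk is finite at every finite time, so a car that drifts off without visiting \<open>i\<close> has
  \<open>\<tau> = \<infinity>\<close>, the infimum of the empty set.
\<close>

definition \<tau> :: "(nat \<Rightarrow> nat) \<Rightarrow> nat \<Rightarrow> (nat \<Rightarrow> nat \<Rightarrow> bool) \<Rightarrow> enat" where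
  "\<tau> \<alpha> i \<omega> = Inf {enat t | t. Z \<alpha> i \<omega> t = int i}"

text \<open>
  Expectation of a nonnegative variable conditioned on an event of positive probability, that is,
  its expectation under the conditional probability measure given that event.
\<close>

definition cond_expectation :: "'a measure \<Rightarrow> ('a \<Rightarrow> ennreal) \<Rightarrow> ('a \<Rightarrow> bool) \<Rightarrow> ennreal" where
  "cond_expectation M f P = (\<integral>\<^sup>+ \<omega>. f \<omega> \<partial>uniform_measure M {\<omega> \<in> space M. P \<omega>})"

end

theory Submission
  imports Defs
begin

text \<open>
  Since \<open>\<alpha> i \<le> i\<close> for every \<open>i\<close>, a car \<open>i\<close> that finds exactly the spots \<open>1, \<dots>, i - 1\<close> taken
  starts at or below \<open>i\<close> and moves by unit steps, so the first free spot it can meet is \<open>i\<close> itself.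
  Hence, by induction, cars \<open>1, \<dots>, k\<close> all park if and only if the free walk of each car \<open>j \<le> k\<close>
  rises by \<open>d\<^sub>j = j - \<alpha> j\<close> at some time (\<open>occupied_eq\<close>). These events concern different cars and are
  independent, so conditioning on the earlier cars changes nothing as long as it is possible at all,
  and everything is reduced to the time \<open>T\<^sub>d\<close> at which one biased walk from \<open>0\<close> first reaches \<open>d\<close>.
  The case of an impossible condition with \<open>d\<^sub>i > 0\<close> arises only for \<open>p = 0\<close>; there the quotient
  \<open>0 / 0 = 0\<close> agrees with the series, all of whose terms vanish.

  The law of \<open>T\<^sub>d\<close> is governed by a single recursion, conditioning on the first step: the law of
  \<open>T\<^bsub>d+1\<^esub>\<close> is the mixture, with weights \<open>p\<close> and \<open>1 - p\<close>, of the laws of \<open>1 + T\<^sub>d\<close> and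
  \<open>1 + T\<^bsub>d+2\<^esub>\<close> (\<open>nn_integral_hitting_time_Suc\<close>). It is applied to several functions of \<open>T\<^sub>d\<close>.

  For the indicator of \<open>T\<^sub>d = n\<close> it gives the point probabilities by induction on \<open>n\<close>, because the
  coefficients \<open>d / (l + d) * ((2 l + d - 1) choose l)\<close> satisfy a Pascal-type rule
  (\<open>first_passage_paths_Suc_Suc\<close>); summing over \<open>n = d + 2 l\<close> gives the series for
  \<open>P(T\<^sub>d < \<infinity>)\<close>.

  For the indicator of \<open>T\<^sub>d \<le> n\<close> and \<open>p < 1/2\<close>, induction on \<open>n\<close> gives the bound
  \<open>(p / (1 - p))\<^sup>d\<close>, so \<open>P(T\<^sub>d < \<infinity>) < 1\<close> when \<open>d > 0\<close>.

  For \<open>p \<ge> 1/2\<close> the function \<open>d \<mapsto> 1 - P(T\<^sub>d < \<infinity>)\<close> is nonnegative, vanishes at \<open>0\<close> and is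
  harmonic for the walk. The increments of a harmonic function grow by the factor
  \<open>p / (1 - p) \<ge> 1\<close>, so a nonzero one of this kind cannot be bounded: \<open>P(T\<^sub>d < \<infinity>) = 1\<close>. The mean
  is found in the same way for \<open>p > 1/2\<close>: truncating \<open>T\<^sub>d\<close> shows that its mean is at most
  \<open>d / (p - q)\<close>, the difference of the two is nonnegative and harmonic and vanishes at \<open>0\<close>, and as
  it grows at most linearly while its increments would grow geometrically, it is zero
  (\<open>biased_harmonic_eq_0\<close>).
\<close>

section \<open>Passage times of a nearest-neighbour path\<close>

text \<open>Passage events are written as \<open>T \<noteq> \<infinity>\<close> throughout, a form the simplifier should not expand.\<close>

declare not_infinity_eq [simp del]

definition hitting_time :: "nat \<Rightarrow> (nat \<Rightarrow> bool) \<Rightarrow> enat" where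
  "hitting_time d w = Inf {enat t | t. walk 0 w t = int d}"

text \<open>The form with a least witness is the one to which the measurability rules apply.\<close>

lemma hitting_time_conv_Least:
  "hitting_time d w =
     (if \<exists>t. walk 0 w t = int d then enat (LEAST t. walk 0 w t = int d) else \<infinity>)"
proof (cases "\<exists>t. walk 0 w t = int d")
  case True
  have "hitting_time d w = enat (LEAST t. walk 0 w t = int d)"
    unfolding hitting_time_def
    by (rule Inf_eqI) (use LeastI_ex[OF True] in \<open>auto intro: Least_le\<close>)
  with True show ?thesis by simp
next
  case False
  then show ?thesis by (simp add: hitting_time_def Inf_enat_def)
qed

lemma hitting_time_finite_iff: "hitting_time d w \<noteq> \<infinity> \<longleftrightarrow> (\<exists>t. walk 0 w t = int d)"
  by (simp add: hitting_time_conv_Least)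

lemma hitting_time_0: "hitting_time 0 w = 0"
proof -
  have "hitting_time 0 w \<le> enat 0"
    unfolding hitting_time_def by (rule Inf_lower) (auto simp: walk_def)
  then show ?thesis by (simp add: zero_enat_def[symmetric])
qed

lemma eSuc_Inf_enat: "eSuc (Inf A) = Inf (eSuc ` A)"
proof (cases "A = {}")
  case False
  show ?thesis
  proof (rule antisym)
    show "eSuc (Inf A) \<le> Inf (eSuc ` A)"
      by (auto intro!: Inf_greatest Inf_lower)
    from False have "Inf A \<in> A"
      by (metis LeastI_ex Inf_enat_def all_not_in_conv)
    then show "Inf (eSuc ` A) \<le> eSuc (Inf A)"
      by (auto intro: Inf_lower)
  qed
qed (simp add: Inf_enat_def)

lemma walk_case_nat_Suc:
  "walk a (case_nat b w) (Suc t) = (if b then 1 else -1) + walk a w t"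
  by (simp add: walk_def sum.lessThan_Suc_shift del: sum.lessThan_Suc)

text \<open>
  After the first step the walk has \<open>d\<close> or \<open>d + 2\<close> levels left to climb, and what follows is again
  a walk from \<open>0\<close>, driven by the remaining steps. The target \<open>Suc d\<close> is positive, so the passage
  cannot have happened before that step.
\<close>

lemma hitting_time_Suc_case_nat:
  "hitting_time (Suc d) (case_nat b w) = eSuc (hitting_time (if b then d else d + 2) w)"
proof -
  have "{enat t | t. walk 0 (case_nat b w) t = int (Suc d)} =
        eSuc ` {enat t | t. walk 0 w t = int (if b then d else d + 2)}" (is "?A = ?B")
  proof
    show "?A \<subseteq> ?B"
    proof
      fix x assume "x \<in> ?A"
      then obtain t where t: "x = enat t" "walk 0 (case_nat b w) t = int (Suc d)" by auto
      then obtain s where s: "t = Suc s" by (cases t) (auto simp: walk_def)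
      with t have "walk 0 w s = int (if b then d else d + 2)"
        by (auto simp: walk_case_nat_Suc split: if_splits)
      moreover have "x = eSuc (enat s)" using t s by (simp add: eSuc_enat)
      ultimately show "x \<in> ?B" by blast
    qed
    show "?B \<subseteq> ?A"
    proof clarify
      fix t assume "walk 0 w t = int (if b then d else d + 2)"
      then have "walk 0 (case_nat b w) (Suc t) = int (Suc d)"
        by (auto simp: walk_case_nat_Suc split: if_splits)
      then show "\<exists>ta. eSuc (enat t) = enat ta \<and> walk 0 (case_nat b w) ta = int (Suc d)"
        by (auto simp: eSuc_enat)
    qed
  qed
  then show ?thesis by (simp add: hitting_time_def eSuc_Inf_enat)
qed

lemma walk_shift_start:
  "a \<le> i \<Longrightarrow> walk a w t = int i \<longleftrightarrow> walk 0 w t = int (i - a)"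
  by (auto simp: walk_def of_nat_diff)

section \<open>First-step analysis for Bernoulli steps\<close>

definition coin_space :: "real \<Rightarrow> (nat \<Rightarrow> bool) measure" where
  "coin_space p = (\<Pi>\<^sub>M t\<in>(UNIV :: nat set). measure_pmf (bernoulli_pmf p))"

lemma prob_space_coin_space: "prob_space (coin_space p)"
  unfolding coin_space_def by (intro prob_space_PiM prob_space_measure_pmf)

lemma space_coin_space [simp]: "space (coin_space p) = UNIV"
  by (simp add: coin_space_def space_PiM)

lemma measurable_hitting_time [measurable]:
  "hitting_time d \<in> coin_space p \<rightarrow>\<^sub>M count_space UNIV"
proof -
  have [measurable]: "(\<lambda>w. w s) \<in> coin_space p \<rightarrow>\<^sub>M count_space UNIV" for s
    unfolding coin_space_def by measurable
  have [measurable]: "(\<lambda>w. walk 0 w t) \<in> coin_space p \<rightarrow>\<^sub>M count_space UNIV" for t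
  proof (induction t)
    case (Suc t)
    have eq: "(\<lambda>w. walk 0 w (Suc t)) = (\<lambda>w. (\<lambda>(x, b). x + (if b then 1 else -1)) (walk 0 w t, w t))"
      by (auto simp: walk_def fun_eq_iff)
    note [measurable] = Suc.IH
    show ?case unfolding eq by measurable
  qed (simp add: walk_def)
  show ?thesis
    unfolding hitting_time_conv_Least[abs_def] by measurable
qed

text \<open>
  A coin sequence is distributed as an independent coin put in front of a coin sequence, so the
  pathwise decomposition by the first step integrates to a mixture. Keeping \<open>F\<close> arbitrary lets the
  one recursion serve for point probabilities, tails and means.
\<close>

lemma nn_integral_hitting_time_Suc:
  fixes F :: "enat \<Rightarrow> ennreal"
  assumes p: "0 \<le> p" "p \<le> 1"
  shows "(\<integral>\<^sup>+ w. F (hitting_time (Suc d) w) \<partial>coin_space p) =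
    ennreal p * (\<integral>\<^sup>+ w. F (eSuc (hitting_time d w)) \<partial>coin_space p) +
    ennreal (1 - p) * (\<integral>\<^sup>+ w. F (eSuc (hitting_time (d + 2) w)) \<partial>coin_space p)"
proof -
  let ?B = "measure_pmf (bernoulli_pmf p)" and ?S = "coin_space p"
  interpret S: prob_space ?S by (rule prob_space_coin_space)
  interpret sequence_space ?B by unfold_locales
  have iter: "?S = distr (?B \<Otimes>\<^sub>M ?S) ?S (\<lambda>(b, w). case_nat b w)"
    unfolding coin_space_def by (rule PiM_iter[symmetric])
  have [measurable]: "(\<lambda>(b, w). case_nat b w) \<in> ?B \<Otimes>\<^sub>M ?S \<rightarrow>\<^sub>M ?S"
    unfolding coin_space_def by measurable
  have [measurable]: "F \<in> borel_measurable (count_space UNIV)" by simp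
  have m: "(\<lambda>w. F (hitting_time e w)) \<in> borel_measurable ?S" for e
    by measurable
  have "(\<integral>\<^sup>+ w. F (hitting_time (Suc d) w) \<partial>?S) =
    (\<integral>\<^sup>+ x. F (hitting_time (Suc d) (case x of (b, w) \<Rightarrow> case_nat b w)) \<partial>(?B \<Otimes>\<^sub>M ?S))"
    by (subst iter, subst nn_integral_distr) (auto intro: m)
  also have "\<dots> = (\<integral>\<^sup>+ b. \<integral>\<^sup>+ w. F (hitting_time (Suc d) (case_nat b w)) \<partial>?S \<partial>?B)"
    by (subst S.nn_integral_fst[symmetric]) (simp_all add: split_beta')
  also have "\<dots> = (\<integral>\<^sup>+ b. \<integral>\<^sup>+ w. F (eSuc (hitting_time (if b then d else d + 2) w)) \<partial>?S \<partial>?B)"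
    by (simp only: hitting_time_Suc_case_nat)
  also have "\<dots> = ennreal p * (\<integral>\<^sup>+ w. F (eSuc (hitting_time d w)) \<partial>?S) +
    ennreal (1 - p) * (\<integral>\<^sup>+ w. F (eSuc (hitting_time (d + 2) w)) \<partial>?S)"
    by (subst nn_integral_bernoulli_pmf) (use p in \<open>auto simp: mult.commute\<close>)
  finally show ?thesis .
qed

definition hitting_prob :: "real \<Rightarrow> nat \<Rightarrow> (enat \<Rightarrow> bool) \<Rightarrow> real" where
  "hitting_prob p d Q = measure (coin_space p) {w. Q (hitting_time d w)}"

lemma sets_hitting_time [measurable]: "{w. Q (hitting_time d w)} \<in> sets (coin_space p)"
proof -
  have "hitting_time d -` {t. Q t} \<inter> space (coin_space p) \<in> sets (coin_space p)"
    by (rule measurable_sets[OF measurable_hitting_time]) simp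
  then show ?thesis by (simp add: vimage_def)
qed

lemma hitting_prob_0: "hitting_prob p 0 Q = (if Q 0 then 1 else 0)"
  using prob_space.prob_space[OF prob_space_coin_space[of p]]
  by (simp add: hitting_prob_def hitting_time_0)

lemma hitting_prob_nonneg [simp]: "0 \<le> hitting_prob p d Q"
  by (simp add: hitting_prob_def)

lemma hitting_prob_le_1 [simp]: "hitting_prob p d Q \<le> 1"
  unfolding hitting_prob_def by (rule prob_space.prob_le_1[OF prob_space_coin_space])

lemma hitting_prob_False [simp]: "hitting_prob p d (\<lambda>t. False) = 0"
  by (simp add: hitting_prob_def)

lemma hitting_prob_Suc:
  assumes p: "0 \<le> p" "p \<le> 1"
  shows "hitting_prob p (Suc d) Q =
    p * hitting_prob p d (\<lambda>t. Q (eSuc t)) + (1 - p) * hitting_prob p (d + 2) (\<lambda>t. Q (eSuc t))"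
proof -
  interpret S: prob_space "coin_space p" by (rule prob_space_coin_space)
  have eq: "(\<integral>\<^sup>+ w. indicator {t. R t} (hitting_time e w) \<partial>coin_space p) = ennreal (hitting_prob p e R)"
    for e R
  proof -
    have "(\<integral>\<^sup>+ w. indicator {t. R t} (hitting_time e w) \<partial>coin_space p) =
      (\<integral>\<^sup>+ w. indicator {w. R (hitting_time e w)} w \<partial>coin_space p)"
      by (intro nn_integral_cong) (auto simp: indicator_def)
    then show ?thesis by (simp add: S.emeasure_eq_measure hitting_prob_def)
  qed
  have "ennreal (hitting_prob p (Suc d) Q) =
    ennreal p * ennreal (hitting_prob p d (\<lambda>t. Q (eSuc t))) +
    ennreal (1 - p) * ennreal (hitting_prob p (d + 2) (\<lambda>t. Q (eSuc t)))"
    unfolding eq[symmetric]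
    using nn_integral_hitting_time_Suc[OF p, of "indicator {t. Q t}" d]
    by (simp add: indicator_def)
  also have "\<dots> = ennreal (p * hitting_prob p d (\<lambda>t. Q (eSuc t)) +
      (1 - p) * hitting_prob p (d + 2) (\<lambda>t. Q (eSuc t)))"
    using p by (simp add: ennreal_mult ennreal_plus)
  finally show ?thesis
    using p by (subst (asm) ennreal_inj) auto
qed

lemma hitting_prob_finite_Suc:
  assumes p: "0 \<le> p" "p \<le> 1"
  shows "hitting_prob p (Suc d) (\<lambda>t. t \<noteq> \<infinity>) =
    p * hitting_prob p d (\<lambda>t. t \<noteq> \<infinity>) + (1 - p) * hitting_prob p (d + 2) (\<lambda>t. t \<noteq> \<infinity>)"
proof -
  have "(\<lambda>t. eSuc t \<noteq> \<infinity>) = (\<lambda>t. t \<noteq> \<infinity>)"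
    by (auto simp: fun_eq_iff eSuc_def split: enat.splits)
  then show ?thesis using hitting_prob_Suc[OF p, of d "\<lambda>t. t \<noteq> \<infinity>"] by simp
qed

lemma hitting_prob_finite_pos:
  assumes p: "0 < p" "p \<le> 1"
  shows "hitting_prob p d (\<lambda>t. t \<noteq> \<infinity>) > 0"
proof (induction d)
  case (Suc d)
  have "0 < p * hitting_prob p d (\<lambda>t. t \<noteq> \<infinity>)" using Suc p by simp
  also have "\<dots> \<le> hitting_prob p (Suc d) (\<lambda>t. t \<noteq> \<infinity>)"
    using p hitting_prob_finite_Suc[of p d] by (simp del: not_infinity_eq)
  finally show ?case .
qed (simp add: hitting_prob_0)

section \<open>The distribution of the passage time\<close>

text \<open>
  This is the number of \<open>\<plusminus>1\<close> paths with \<open>l\<close> down-steps whose first visit to level \<open>d\<close> is their last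
  point. The value \<open>1\<close> for \<open>l = d = 0\<close> accounts for the empty path.
\<close>

definition first_passage_paths :: "nat \<Rightarrow> nat \<Rightarrow> real" where
  "first_passage_paths d l =
     (if l + d = 0 then 1 else real d / real (l + d) * real ((2 * l + d - 1) choose l))"

lemma first_passage_paths_Suc_0: "first_passage_paths (Suc d) 0 = first_passage_paths d 0"
  by (simp add: first_passage_paths_def)

text \<open>
  Splitting paths by their first step: an up-step leaves \<open>d\<close> levels to climb, a down-step leaves
  \<open>d + 2\<close> levels and uses up one of the down-steps. With \<open>c\<close> the binomial coefficient of the last
  term, both other binomial coefficients are rational multiples of \<open>c\<close>, and the identity becomes one
  between rational functions.
\<close>

lemma first_passage_paths_Suc_Suc:
  "first_passage_paths (Suc d) (Suc k) =
     first_passage_paths d (Suc k) + first_passage_paths (d + 2) k"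
proof -
  define c where "c = real ((2 * k + d + 1) choose k)"
  have "Suc k * ((2 * k + d + 1) choose Suc k) = ((2 * k + d + 1) choose k) * (k + d + 1)"
    using binomial_absorb_comp[of "2 * k + d + 1" k] binomial_absorption[of k "2 * k + d + 1"]
    by (simp add: Suc_times_binomial_eq binomial_absorption algebra_simps)
  then have "real (Suc k) * real ((2 * k + d + 1) choose Suc k) = c * real (k + d + 1)"
    unfolding c_def by (metis of_nat_mult)
  then have next_binomial: "real ((2 * k + d + 1) choose Suc k) = c * real (k + d + 1) / real (Suc k)"
    by (simp add: field_simps)
  have "real ((2 * k + d + 2) choose Suc k) = c + c * real (k + d + 1) / real (Suc k)"
    using next_binomial by (simp add: c_def)
  then have "first_passage_paths (Suc d) (Suc k) =
      real (d + 1) / real (k + d + 2) * (c + c * real (k + d + 1) / real (Suc k))"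
    by (simp add: first_passage_paths_def algebra_simps)
  also have "\<dots> = real d / real (k + d + 1) * (c * real (k + d + 1) / real (Suc k)) +
      real (d + 2) / real (k + d + 2) * c"
    by (simp add: divide_simps) (simp add: algebra_simps)
  also have "\<dots> = first_passage_paths d (Suc k) + first_passage_paths (d + 2) k"
    using next_binomial by (simp add: first_passage_paths_def c_def algebra_simps)
  finally show ?thesis .
qed

text \<open>
  Induction on the time for all levels at once: the first-step recursion on the left matches the
  recursion of the path counts on the right. A passage to \<open>d\<close> with \<open>l\<close> down-steps has \<open>d + l\<close>
  up-steps, hence takes \<open>d + 2 * l\<close> steps; no other times occur.
\<close>

lemma hitting_prob_eq_enat:
  assumes p: "0 \<le> p" "p \<le> 1"
  shows "hitting_prob p d (\<lambda>t. t = enat n) =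
    (if \<exists>l. n = d + 2 * l
     then first_passage_paths d ((n - d) div 2) * p ^ (d + (n - d) div 2) * (1 - p) ^ ((n - d) div 2)
     else 0)"
proof (induction n arbitrary: d)
  case 0
  show ?case
  proof (cases d)
    case 0
    then show ?thesis
      by (simp add: hitting_prob_0 zero_enat_def[symmetric] first_passage_paths_def)
  next
    case (Suc e)
    then show ?thesis
      using hitting_prob_Suc[OF p, of e "\<lambda>t. t = enat 0"] by (simp add: zero_enat_def[symmetric])
  qed
next
  case (Suc n)
  show ?case
  proof (cases d)
    case 0
    then show ?thesis
      by (auto simp: hitting_prob_0 zero_enat_def first_passage_paths_def)
  next
    case (Suc e)
    have step: "hitting_prob p (Suc e) (\<lambda>t. t = enat (Suc n)) =
      p * hitting_prob p e (\<lambda>t. t = enat n) + (1 - p) * hitting_prob p (e + 2) (\<lambda>t. t = enat n)"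
      by (subst hitting_prob_Suc[OF p]) (simp add: eSuc_enat[symmetric])
    show ?thesis
    proof (cases "\<exists>l. n = e + 2 * l")
      case True
      then obtain l where l: "n = e + 2 * l" by auto
      show ?thesis
      proof (cases l)
        \<comment> \<open>A path without down-steps: after a first down-step, level \<open>e + 2\<close> is too far to reach in
          the remaining \<open>e\<close> steps.\<close>
        case 0
        then have "hitting_prob p (e + 2) (\<lambda>t. t = enat n) = 0"
          using l by (subst Suc.IH) auto
        then show ?thesis
          using 0 l Suc.IH[of e] unfolding \<open>d = Suc e\<close> step
          by (simp add: first_passage_paths_Suc_0)
      next
        case (Suc k)
        have far: "hitting_prob p (e + 2) (\<lambda>t. t = enat n) =
            first_passage_paths (e + 2) k * p ^ (e + 2 + k) * (1 - p) ^ k"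
          using l Suc by (subst Suc.IH) (auto intro: exI[of _ k])
        have "\<exists>j. n = e + 2 * j" "(n - e) div 2 = Suc k"
          using l Suc by (auto intro!: exI[of _ "Suc k"])
        then have near: "hitting_prob p e (\<lambda>t. t = enat n) =
            first_passage_paths e (Suc k) * p ^ (e + Suc k) * (1 - p) ^ Suc k"
          by (subst Suc.IH) simp
        have "hitting_prob p (Suc e) (\<lambda>t. t = enat (Suc n)) =
            first_passage_paths (Suc e) (Suc k) * p ^ (Suc e + Suc k) * (1 - p) ^ Suc k"
          unfolding step near far first_passage_paths_Suc_Suc by (simp add: algebra_simps)
        moreover have "\<exists>j. Suc n = d + 2 * j" "(Suc n - d) div 2 = Suc k"
          using l Suc \<open>d = Suc e\<close> by (auto intro!: exI[of _ "Suc k"])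
        ultimately show ?thesis unfolding \<open>d = Suc e\<close> by simp
      qed
    next
      case False
      moreover from False have "\<not> (\<exists>j. n = e + 2 + 2 * j)"
        by (metis add.assoc distrib_left_numeral mult.right_neutral mult_2 one_add_one)
      ultimately show ?thesis
        using Suc unfolding Suc step by (simp add: Suc.IH)
    qed
  qed
qed

lemma first_passage_sums:
  assumes p: "0 \<le> p" "p \<le> 1"
  shows "(\<lambda>l. first_passage_paths d l * p ^ (d + l) * (1 - p) ^ l)
    sums hitting_prob p d (\<lambda>t. t \<noteq> \<infinity>)"
proof -
  interpret S: prob_space "coin_space p" by (rule prob_space_coin_space)
  have un: "{w. hitting_time d w \<noteq> \<infinity>} = (\<Union>n. {w. hitting_time d w = enat n})"
    by auto
  have "(\<lambda>n. hitting_prob p d (\<lambda>t. t = enat n)) sums hitting_prob p d (\<lambda>t. t \<noteq> \<infinity>)"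
    unfolding hitting_prob_def un
    by (rule S.finite_measure_UNION) (auto simp: disjoint_family_on_def sets_hitting_time)
  then have "(\<lambda>l. hitting_prob p d (\<lambda>t. t = enat (d + 2 * l))) sums hitting_prob p d (\<lambda>t. t \<noteq> \<infinity>)"
    by (subst sums_mono_reindex) (auto simp: strict_mono_def hitting_prob_eq_enat[OF p])
  then show ?thesis by (simp add: hitting_prob_eq_enat[OF p])
qed

section \<open>Harmonic functions for the walk on a half-line\<close>

text \<open>
  Harmonicity at \<open>d + 1\<close> says that \<open>1 - p\<close> times the increment above \<open>d + 1\<close> is \<open>p\<close> times the
  increment below it.
\<close>

lemma biased_harmonic_increments:
  fixes g :: "nat \<Rightarrow> real"
  assumes g: "\<And>d. g (Suc d) = p * g d + (1 - p) * g (d + 2)"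
  shows "(1 - p) ^ d * (g (Suc d) - g d) = p ^ d * (g 1 - g 0)"
proof (induction d)
  case (Suc d)
  have "(1 - p) * (g (Suc (Suc d)) - g (Suc d)) = p * (g (Suc d) - g d)"
    using g[of d] by (simp add: algebra_simps)
  then have "(1 - p) ^ Suc d * (g (Suc (Suc d)) - g (Suc d)) = p * ((1 - p) ^ d * (g (Suc d) - g d))"
    by (metis mult.assoc mult.left_commute power_Suc)
  then show ?case unfolding Suc by (simp add: mult.assoc)
qed simp

text \<open>
  A uniqueness principle of Liouville type. For \<open>p = 1\<close> harmonic functions are constant. Otherwise,
  with \<open>r = p / (1 - p) \<ge> 1\<close> the increments of \<open>g\<close> are
  \<open>r\<^sup>d g(1)\<close>, so \<open>g(1) > 0\<close> would force at least linear growth, and faster than linear growth if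
  \<open>r > 1\<close>. For \<open>p = 1/2\<close> the function \<open>g(d) = d\<close> is harmonic, which is why a linear bound is admitted
  only for \<open>p > 1/2\<close>.
\<close>

lemma biased_harmonic_eq_0:
  fixes g :: "nat \<Rightarrow> real"
  assumes p: "1 / 2 \<le> p" "p \<le> 1"
    and g: "\<And>d. g (Suc d) = p * g d + (1 - p) * g (d + 2)"
    and g0: "g 0 = 0" and nonneg: "\<And>d. g d \<ge> 0"
    and growth: "(\<forall>d. g d \<le> C) \<or> (1 / 2 < p \<and> (\<forall>d. g d \<le> C * real d))"
  shows "g d = 0"
proof (cases "p = 1")
  case True
  with g have "g (Suc d) = g d" for d by simp
  then show ?thesis using g0 by (induction d) auto
next
  case False
  define r where "r = p / (1 - p)"
  have r: "r \<ge> 1" "1 / 2 < p \<Longrightarrow> r > 1" using p False by (auto simp: r_def field_simps)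
  have inc: "g (Suc d) - g d = r ^ d * g 1" for d
    using biased_harmonic_increments[OF g, of d] False
    by (simp add: r_def g0 power_divide field_simps)
  have "g 1 = 0"
  proof (rule ccontr)
    assume "g 1 \<noteq> 0"
    with nonneg[of 1] have pos: "g 1 > 0" by simp
    from growth show False
    proof
      assume bound: "\<forall>d. g d \<le> C"
      have lin: "real d * g 1 \<le> g d" for d
      proof (induction d)
        case (Suc d)
        have "1 * g 1 \<le> r ^ d * g 1" using pos r by (intro mult_right_mono) auto
        with Suc inc[of d] show ?case by (simp add: algebra_simps)
      qed (simp add: g0)
      obtain N :: nat where "C / g 1 < real N" using reals_Archimedean2 by blast
      with lin[of N] bound pos show False by (auto simp: field_simps dest!: spec[of _ N])
    next
      assume *: "1 / 2 < p \<and> (\<forall>d. g d \<le> C * real d)"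
      \<comment> \<open>Bernoulli's inequality turns the geometric growth of the increments into linear growth,
        hence quadratic growth of \<open>g\<close>, which already beats a linear bound.\<close>
      define b where "b = r - 1"
      have b: "b > 0" using * r by (simp add: b_def)
      have lin: "(1 + real d * b) * g 1 \<le> g (Suc d) - g d" for d
        unfolding inc using Bernoulli_inequality[of b d] b pos
        by (intro mult_right_mono) (auto simp: b_def)
      have quad: "real d * (real d - 1) / 2 * b * g 1 \<le> g d" for d
      proof (induction d)
        case (Suc d)
        have "real d * b * g 1 \<le> g (Suc d) - g d" using lin[of d] pos by (simp add: algebra_simps)
        with Suc show ?case by (simp add: field_simps)
      qed (simp add: g0)
      obtain N :: nat where N: "2 * C / (b * g 1) + 1 < real N" using reals_Archimedean2 by blast
      have C: "C \<ge> 0" using * nonneg[of 1] by (auto dest!: spec[of _ "1::nat"])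
      then have Npos: "real N > 0" using N b pos
        by (smt (verit) divide_nonneg_pos mult_pos_pos)
      have "2 * C < (real N - 1) * (b * g 1)"
        using N b pos by (simp add: field_simps)
      then have "real N * (2 * C) < real N * ((real N - 1) * (b * g 1))"
        using Npos by simp
      moreover have "g N \<le> C * real N" using * by blast
      ultimately show False using quad[of N] by (simp add: field_simps)
    qed
  qed
  then have "g (Suc d) = g d" for d using inc[of d] by simp
  then show ?thesis using g0 by (induction d) auto
qed

section \<open>Recurrence, transience and the mean passage time\<close>

lemma hitting_prob_finite_eq_1:
  assumes p: "1 / 2 \<le> p" "p \<le> 1"
  shows "hitting_prob p d (\<lambda>t. t \<noteq> \<infinity>) = 1"
proof -
  have p': "0 \<le> p" using p by simp
  have "1 - hitting_prob p d (\<lambda>t. t \<noteq> \<infinity>) = 0"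
  proof (rule biased_harmonic_eq_0[OF p, where C = 1])
    fix e
    show "1 - hitting_prob p (Suc e) (\<lambda>t. t \<noteq> \<infinity>) =
      p * (1 - hitting_prob p e (\<lambda>t. t \<noteq> \<infinity>)) + (1 - p) * (1 - hitting_prob p (e + 2) (\<lambda>t. t \<noteq> \<infinity>))"
      unfolding hitting_prob_finite_Suc[OF p' p(2)] by (simp add: algebra_simps)
  qed (auto simp: hitting_prob_0)
  then show ?thesis by simp
qed

text \<open>
  The function \<open>d \<mapsto> (p / (1 - p))\<^sup>d\<close> is harmonic, equals \<open>1\<close> at \<open>0\<close> and dominates the probability
  of a passage by time \<open>0\<close>; each further first step preserves the domination.
\<close>

lemma hitting_prob_le_power:
  assumes p: "0 \<le> p" "p < 1"
  shows "hitting_prob p d (\<lambda>t. t \<le> enat n) \<le> (p / (1 - p)) ^ d"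
proof (induction n arbitrary: d)
  case 0
  show ?case
  proof (cases d)
    case (Suc e)
    then show ?thesis
      using p hitting_prob_Suc[of p e "\<lambda>t. t \<le> enat 0"] by (simp add: zero_enat_def[symmetric])
  qed (simp add: hitting_prob_0)
next
  case (Suc n)
  show ?case
  proof (cases d)
    case (Suc e)
    let ?r = "p / (1 - p)"
    have "hitting_prob p d (\<lambda>t. t \<le> enat (Suc n)) =
      p * hitting_prob p e (\<lambda>t. t \<le> enat n) + (1 - p) * hitting_prob p (e + 2) (\<lambda>t. t \<le> enat n)"
      using p unfolding Suc by (subst hitting_prob_Suc) (simp_all add: eSuc_enat[symmetric])
    also have "\<dots> \<le> p * ?r ^ e + (1 - p) * ?r ^ (e + 2)"
      using p by (intro add_mono mult_left_mono Suc.IH) auto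
    also have "\<dots> = ?r ^ e * (p + (1 - p) * ?r\<^sup>2)"
      by (simp add: algebra_simps power2_eq_square)
    also have "p + (1 - p) * ?r\<^sup>2 = ?r"
      using p by (simp add: divide_simps power2_eq_square) (simp add: algebra_simps)
    finally show ?thesis by (simp add: Suc mult.commute)
  qed (simp add: hitting_prob_0)
qed

lemma hitting_prob_finite_less_1:
  assumes p: "0 \<le> p" "p < 1 / 2" and d: "d > 0"
  shows "hitting_prob p d (\<lambda>t. t \<noteq> \<infinity>) < 1"
proof -
  interpret S: prob_space "coin_space p" by (rule prob_space_coin_space)
  have "(\<lambda>n. hitting_prob p d (\<lambda>t. t \<le> enat n)) \<longlonglongrightarrow>
    measure (coin_space p) (\<Union>n. {w. hitting_time d w \<le> enat n})"
    unfolding hitting_prob_def by (rule S.finite_Lim_measure_incseq)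
       (auto simp: incseq_def sets_hitting_time intro: order_trans)
  also have "(\<Union>n. {w. hitting_time d w \<le> enat n}) = {w. hitting_time d w \<noteq> \<infinity>}"
    by (auto simp: not_infinity_eq elim: enat_ile)
  finally have "hitting_prob p d (\<lambda>t. t \<noteq> \<infinity>) \<le> (p / (1 - p)) ^ d"
    using hitting_prob_le_power[of p d] p unfolding hitting_prob_def by (intro LIMSEQ_le_const2) auto
  also have "\<dots> < 1"
    using p d by (simp add: power_less_one_iff)
  finally show ?thesis .
qed

lemma min_eSuc: "min (eSuc s) (eSuc t) = eSuc (min s t)"
  by (simp add: min_def)

text \<open>
  The function \<open>d \<mapsto> d / (2 * p - 1)\<close> solves the recursion \<open>m(d+1) = 1 + p m(d) + (1 - p) m(d+2)\<close> of
  the mean; since truncated means are finite and start at \<open>0\<close>, induction on the truncation keeps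
  them below this solution. This also yields that the mean itself is finite.
\<close>

lemma nn_integral_min_hitting_time_le:
  assumes p: "1 / 2 < p" "p \<le> 1"
  shows "(\<integral>\<^sup>+ w. ennreal_of_enat (min (hitting_time d w) (enat n)) \<partial>coin_space p)
    \<le> ennreal (real d / (2 * p - 1))"
proof (induction n arbitrary: d)
  case 0
  then show ?case by (simp add: zero_enat_def[symmetric])
next
  case (Suc n)
  interpret S: prob_space "coin_space p" by (rule prob_space_coin_space)
  show ?case
  proof (cases d)
    case 0
    then show ?thesis by (simp add: hitting_time_0)
  next
    case (Suc e)
    define T where "T = (\<lambda>e. \<integral>\<^sup>+ w. ennreal_of_enat (min (hitting_time e w) (enat n)) \<partial>coin_space p)"
    have one_plus: "(\<integral>\<^sup>+ w. 1 + ennreal_of_enat (min (hitting_time e w) (enat n)) \<partial>coin_space p) = 1 + T e" for e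
      unfolding T_def
      by (subst nn_integral_add) (simp_all add: S.emeasure_space_1[simplified])
    have "(\<integral>\<^sup>+ w. ennreal_of_enat (min (hitting_time d w) (enat (Suc n))) \<partial>coin_space p)
      = ennreal p * (1 + T e) + ennreal (1 - p) * (1 + T (e + 2))"
      using p unfolding Suc
      by (subst nn_integral_hitting_time_Suc[where F = "\<lambda>t. ennreal_of_enat (min t (enat (Suc n)))"])
         (simp_all add: eSuc_enat[symmetric] min_eSuc one_plus[simplified])
    also have "\<dots> \<le> ennreal p * (1 + ennreal (real e / (2 * p - 1)))
        + ennreal (1 - p) * (1 + ennreal (real (e + 2) / (2 * p - 1)))"
      unfolding T_def by (intro add_mono mult_left_mono Suc.IH) auto
    also have "\<dots> = ennreal (p * (1 + real e / (2 * p - 1)) + (1 - p) * (1 + real (e + 2) / (2 * p - 1)))"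
      using p by (simp add: ennreal_mult ennreal_plus flip: ennreal_1)
    also have "p * (1 + real e / (2 * p - 1)) + (1 - p) * (1 + real (e + 2) / (2 * p - 1)) =
        real d / (2 * p - 1)"
      using p by (simp add: Suc divide_simps) (simp add: algebra_simps)
    finally show ?thesis .
  qed
qed

lemma SUP_min_enat: "(SUP n. ennreal_of_enat (min t (enat n))) = ennreal_of_enat t"
proof (cases t)
  case (enat m)
  show ?thesis
  proof (rule antisym)
    show "ennreal_of_enat t \<le> (SUP n. ennreal_of_enat (min t (enat n)))"
      by (rule SUP_upper2[of m]) (simp_all add: enat)
  qed (auto intro!: SUP_least)
qed (simp add: ennreal_SUP_of_nat_eq_top)

text \<open>
  The mean and \<open>d / (2 * p - 1)\<close> solve the same inhomogeneous recursion, so their difference is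
  harmonic. By the truncated bound it is nonnegative and at most linear in \<open>d\<close>.
\<close>

lemma nn_integral_hitting_time:
  assumes p: "1 / 2 < p" "p \<le> 1"
  shows "(\<integral>\<^sup>+ w. ennreal_of_enat (hitting_time d w) \<partial>coin_space p) = ennreal (real d / (2 * p - 1))"
proof -
  interpret S: prob_space "coin_space p" by (rule prob_space_coin_space)
  define E where "E = (\<lambda>d. \<integral>\<^sup>+ w. ennreal_of_enat (hitting_time d w) \<partial>coin_space p)"
  have E_le: "E d \<le> ennreal (real d / (2 * p - 1))" for d
  proof -
    have "E d = (\<integral>\<^sup>+ w. (SUP n. ennreal_of_enat (min (hitting_time d w) (enat n))) \<partial>coin_space p)"
      by (simp add: E_def SUP_min_enat)
    also have "\<dots> = (SUP n. \<integral>\<^sup>+ w. ennreal_of_enat (min (hitting_time d w) (enat n)) \<partial>coin_space p)"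
      by (rule nn_integral_monotone_convergence_SUP)
         (auto simp: incseq_def le_fun_def min_def, metis linear order_trans enat_ord_simps(1))
    also have "\<dots> \<le> ennreal (real d / (2 * p - 1))"
      by (intro SUP_least nn_integral_min_hitting_time_le p)
    finally show ?thesis .
  qed
  define e where "e = (\<lambda>d. enn2real (E d))"
  have E_eq: "E d = ennreal (e d)" for d
    unfolding e_def using E_le[of d] by (metis ennreal_enn2real ennreal_less_top le_less_trans)
  have e_nonneg: "e d \<ge> 0" for d by (simp add: e_def)
  have e_le: "e d \<le> real d / (2 * p - 1)" for d
    using E_le[of d] p unfolding E_eq by (subst (asm) ennreal_le_iff) auto
  have one_plus: "(\<integral>\<^sup>+ w. 1 + ennreal_of_enat (hitting_time k w) \<partial>coin_space p) = 1 + E k" for k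
    unfolding E_def by (subst nn_integral_add) (simp_all add: S.emeasure_space_1[simplified])
  have e_Suc: "e (Suc k) = p * (1 + e k) + (1 - p) * (1 + e (k + 2))" for k
  proof -
    have "ennreal (e (Suc k)) = E (Suc k)" by (simp only: E_eq)
    also have "\<dots> = ennreal p * (1 + E k) + ennreal (1 - p) * (1 + E (k + 2))"
      using p unfolding E_def[THEN fun_cong, of "Suc k"]
      by (subst nn_integral_hitting_time_Suc) (simp_all add: one_plus[simplified])
    also have "\<dots> = ennreal (p * (1 + e k) + (1 - p) * (1 + e (k + 2)))"
      using p e_nonneg unfolding E_eq by (simp add: ennreal_mult ennreal_plus flip: ennreal_1)
    finally show ?thesis
      using p e_nonneg by (subst (asm) ennreal_inj) auto
  qed
  have "real d / (2 * p - 1) - e d = 0"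
  proof (rule biased_harmonic_eq_0[where p = p and C = "1 / (2 * p - 1)"])
    fix k
    show "real (Suc k) / (2 * p - 1) - e (Suc k) =
      p * (real k / (2 * p - 1) - e k) + (1 - p) * (real (k + 2) / (2 * p - 1) - e (k + 2))"
      using p unfolding e_Suc by (simp add: divide_simps) (simp add: algebra_simps)
  next
    show "real 0 / (2 * p - 1) - e 0 = 0"
      by (simp add: e_def E_def hitting_time_0)
  qed (use p e_le e_nonneg in auto)
  then show ?thesis using E_eq[of d] by (simp add: E_def)
qed

section \<open>Parking with identity outcome\<close>

text \<open>Classical cars only move to the right of their preference.\<close>

lemma classical_park_prefers:
  "classical_park n \<alpha> k s = Some c \<Longrightarrow> \<alpha> c \<le> s"
proof (induction k)
  case (Suc k)
  define free where "free = {\<alpha> (Suc k)..n} - dom (classical_park n \<alpha> k)"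
  show ?case
  proof (cases "free \<noteq> {} \<and> s = Min free")
    case True
    then have "Min free \<in> free" by (intro Min_in) (auto simp: free_def)
    then have "\<alpha> (Suc k) \<le> s" using True by (simp add: free_def)
    moreover have "c = Suc k"
      using Suc.prems True unfolding classical_park.simps Let_def free_def[symmetric] by simp
    ultimately show ?thesis by simp
  next
    case False
    then have "classical_park n \<alpha> k s = Some c"
      using Suc.prems unfolding classical_park.simps Let_def free_def[symmetric]
      by (auto split: if_splits)
    then show ?thesis by (rule Suc.IH)
  qed
qed simp

lemma identity_outcome_le:
  "identity_outcome n \<alpha> \<Longrightarrow> i \<in> {1..n} \<Longrightarrow> \<alpha> i \<le> i"
  unfolding identity_outcome_def classical_outcome_def by (blast intro: classical_park_prefers)

lemma walk_visits_below:
  assumes "a \<le> i" "int i \<le> walk a w t"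
  obtains s where "s \<le> t" "walk a w s = int i"
proof -
  have "\<exists>s\<le>t. walk a w s = int i"
    by (rule nat0_intermed_int_val) (use assms in \<open>auto simp: walk_def\<close>)
  then show ?thesis using that by blast
qed

text \<open>
  The free spots are \<open>i, \<dots>, n\<close>. A walk that starts at or below \<open>i\<close> cannot be at any of them
  without having been at \<open>i\<close> before, by the discrete intermediate value theorem.
\<close>

lemma park_spot_initial_segment:
  assumes "a \<le> i" "1 \<le> i" "i \<le> n"
  shows "park_spot n {1..<i} a w = (if \<exists>t. walk a w t = int i then Some i else None)"
proof -
  let ?R = "reaches_free n {1..<i} a w"
  have R: "?R t \<longleftrightarrow> int i \<le> walk a w t \<and> walk a w t \<le> int n" for t
  proof
    assume "int i \<le> walk a w t \<and> walk a w t \<le> int n"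
    then show "?R t"
      unfolding reaches_free_def using assms
      by (intro image_eqI[where x = "nat (walk a w t)"]) auto
  qed (auto simp: reaches_free_def)
  have iff: "(\<exists>t. ?R t) \<longleftrightarrow> (\<exists>t. walk a w t = int i)"
    unfolding R using assms(3) walk_visits_below[OF assms(1)]
    by (metis order_refl of_nat_le_iff)
  show ?thesis
  proof (cases "\<exists>t. ?R t")
    case True
    define t where "t = (LEAST t. ?R t)"
    have "?R t" unfolding t_def using True by (rule LeastI_ex)
    then obtain s where s: "s \<le> t" "walk a w s = int i"
      using walk_visits_below[OF assms(1)] R by blast
    then have "?R s" using assms unfolding R by simp
    then have "t \<le> s" unfolding t_def by (rule Least_le)
    with s have "walk a w t = int i" by simp
    then have "park_spot n {1..<i} a w = Some i"
      using True unfolding park_spot_def t_def[symmetric] by simp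
    then show ?thesis using True iff by simp
  next
    case False
    then show ?thesis using iff by (simp add: park_spot_def)
  qed
qed

text \<open>
  This is the event that the free walk of car \<open>i\<close> visits spot \<open>i\<close>, whatever the other cars do. Being
  an event about the steps of one car only, it is independent of the same event for other cars.
\<close>

abbreviation "parks \<alpha> i \<omega> \<equiv> hitting_time (displacement \<alpha> i) (\<omega> i) \<noteq> \<infinity>"

lemma occupied_eq:
  assumes "\<forall>i\<in>{1..n}. \<alpha> i \<le> i" "k \<le> n"
  shows "occupied n \<alpha> \<omega> k = (if \<forall>i\<in>{1..k}. parks \<alpha> i \<omega> then Some {1..k} else None)"
  using assms(2)
proof (induction k)
  case (Suc k)
  have le: "\<alpha> (Suc k) \<le> Suc k" using assms(1) Suc by auto
  have "(\<exists>t. walk (\<alpha> (Suc k)) (\<omega> (Suc k)) t = int (Suc k)) \<longleftrightarrow> parks \<alpha> (Suc k) \<omega>"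
    by (simp only: walk_shift_start[OF le] hitting_time_finite_iff displacement_def)
  then have spot: "park_spot n {1..k} (\<alpha> (Suc k)) (\<omega> (Suc k)) =
      (if parks \<alpha> (Suc k) \<omega> then Some (Suc k) else None)"
    using park_spot_initial_segment[OF le, of n "\<omega> (Suc k)"] Suc.prems
    by (simp only: atLeastLessThanSuc_atLeastAtMost)
  have "{1..Suc k} = insert (Suc k) {1..k}" by auto
  then show ?case using Suc spot by auto
qed simp

lemma X_eq:
  assumes "\<forall>i\<in>{1..n}. \<alpha> i \<le> i" "k \<le> n"
  shows "X n \<alpha> k \<omega> = (if \<forall>i\<in>{1..k}. parks \<alpha> i \<omega> then 1 else 0)"
  using occupied_eq[of n \<alpha> k \<omega>] assms by (simp add: X_def)

lemma prod_X_eq_1_iff: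
  assumes "\<forall>i\<in>{1..n}. \<alpha> i \<le> i" "k \<le> n"
  shows "(\<Prod>j=1..k. X n \<alpha> j \<omega>) = 1 \<longleftrightarrow> (\<forall>i\<in>{1..k}. parks \<alpha> i \<omega>)"
proof (cases "\<forall>i\<in>{1..k}. parks \<alpha> i \<omega>")
  case True
  then have "X n \<alpha> j \<omega> = 1" if "j \<in> {1..k}" for j
    using that assms(2) by (subst X_eq[OF assms(1)]) auto
  then show ?thesis using True by simp
next
  case False
  then have "k \<in> {1..k}" "X n \<alpha> k \<omega> = 0" using X_eq[OF assms, of \<omega>] by auto
  then have "(\<Prod>j=1..k. X n \<alpha> j \<omega>) = 0" by (intro prod_zero) auto
  then show ?thesis using False by (simp only: zero_neq_one)
qed

lemma \<tau>_eq_hitting_time: "\<alpha> i \<le> i \<Longrightarrow> \<tau> \<alpha> i \<omega> = hitting_time (displacement \<alpha> i) (\<omega> i)"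
  by (simp add: \<tau>_def Z_def hitting_time_def displacement_def walk_shift_start)

lemma step_space_eq: "step_space p = (\<Pi>\<^sub>M i\<in>(UNIV :: nat set). coin_space p)"
  by (simp add: step_space_def coin_space_def)

lemma space_step_space [simp]: "space (step_space p) = UNIV"
  by (simp add: step_space_eq space_PiM)

lemma emeasure_parks_all:
  assumes "finite J"
  shows "emeasure (step_space p) {\<omega>. \<forall>i\<in>J. parks \<alpha> i \<omega>} =
    ennreal (\<Prod>i\<in>J. hitting_prob p (displacement \<alpha> i) (\<lambda>t. t \<noteq> \<infinity>))"
proof -
  interpret S: prob_space "coin_space p" by (rule prob_space_coin_space)
  interpret product_prob_space "\<lambda>i. coin_space p" "UNIV :: nat set" by unfold_locales
  show ?thesis
    using emeasure_PiM_Collect[of J "\<lambda>i. {w. hitting_time (displacement \<alpha> i) w \<noteq> \<infinity>}"] assms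
    by (simp add: step_space_eq[symmetric] sets_hitting_time S.emeasure_eq_measure prod_ennreal hitting_prob_def)
qed

lemma measure_parks_all:
  assumes "finite J"
  shows "measure (step_space p) {\<omega>. \<forall>i\<in>J. parks \<alpha> i \<omega>} =
    (\<Prod>i\<in>J. hitting_prob p (displacement \<alpha> i) (\<lambda>t. t \<noteq> \<infinity>))"
  unfolding measure_def emeasure_parks_all[OF assms] by (rule enn2real_ennreal) (simp add: prod_nonneg)

lemma measurable_hitting_time_component [measurable]:
  "(\<lambda>\<omega>. hitting_time d (\<omega> i)) \<in> step_space p \<rightarrow>\<^sub>M count_space UNIV"
  unfolding step_space_eq by measurable

text \<open>
  For \<open>p > 1/2\<close> the condition has probability \<open>1\<close>, so the conditional expectation is the plain mean
  of the passage time of car \<open>i\<close>.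
\<close>

lemma cond_expectation_\<tau>:
  assumes \<alpha>: "\<forall>j\<in>{1..n}. \<alpha> j \<le> j" and i: "1 \<le> i" "i \<le> n"
    and p: "1 / 2 < p" "p \<le> 1"
  shows "cond_expectation (step_space p) (\<lambda>\<omega>. ennreal_of_enat (\<tau> \<alpha> i \<omega>))
      (\<lambda>\<omega>. (\<Prod>j=1..i. X n \<alpha> j \<omega>) = 1) = ennreal (real (displacement \<alpha> i) / (2 * p - 1))"
proof -
  define A where "A = {\<omega>. \<forall>j\<in>{1..i}. parks \<alpha> j \<omega>}"
  let ?d = "displacement \<alpha> i"
  let ?f = "\<lambda>w. ennreal_of_enat (hitting_time ?d w)"
  have "{\<omega> \<in> space (step_space p). \<forall>j\<in>{1..i}. parks \<alpha> j \<omega>} \<in> sets (step_space p)"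
    by measurable
  then have A_sets [measurable]: "A \<in> sets (step_space p)" by (simp add: A_def)
  have A_1: "emeasure (step_space p) A = 1"
    unfolding A_def using p by (subst emeasure_parks_all) (auto simp: hitting_prob_finite_eq_1)
  interpret P: prob_space "step_space p"
    unfolding step_space_eq by (intro prob_space_PiM prob_space_coin_space)
  have "AE \<omega> in step_space p. \<omega> \<in> A"
    using A_1 by (intro P.AE_prob_1) (simp add: P.emeasure_eq_measure)
  then have AE: "AE \<omega> in step_space p. ?f (\<omega> i) * indicator A \<omega> = ?f (\<omega> i)"
    by eventually_elim simp
  have set_eq: "{\<omega> \<in> space (step_space p). (\<Prod>j=1..i. X n \<alpha> j \<omega>) = 1} = A"
    unfolding A_def prod_X_eq_1_iff[OF \<alpha> i(2)] by simp
  have "\<alpha> i \<le> i" using \<alpha> i by auto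
  then have "cond_expectation (step_space p) (\<lambda>\<omega>. ennreal_of_enat (\<tau> \<alpha> i \<omega>))
      (\<lambda>\<omega>. (\<Prod>j=1..i. X n \<alpha> j \<omega>) = 1) = (\<integral>\<^sup>+ \<omega>. ?f (\<omega> i) \<partial>uniform_measure (step_space p) A)"
    unfolding cond_expectation_def set_eq by (simp add: \<tau>_eq_hitting_time)
  also have "\<dots> = (\<integral>\<^sup>+ \<omega>. ?f (\<omega> i) * indicator A \<omega> \<partial>step_space p) / emeasure (step_space p) A"
    by (rule nn_integral_uniform_measure) measurable
  also have "\<dots> = (\<integral>\<^sup>+ \<omega>. ?f (\<omega> i) \<partial>step_space p)"
    using nn_integral_cong_AE[OF AE] by (simp add: A_1 divide_ennreal_def)
  also have "\<dots> = (\<integral>\<^sup>+ w. ?f w \<partial>distr (step_space p) (coin_space p) (\<lambda>\<omega>. \<omega> i))"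
    by (rule nn_integral_distr[symmetric]) (auto simp: step_space_eq)
  also have "distr (step_space p) (coin_space p) (\<lambda>\<omega>. \<omega> i) = coin_space p"
    unfolding step_space_eq by (rule distr_PiM_component) (auto intro: prob_space_coin_space)
  finally show ?thesis using nn_integral_hitting_time[OF p] by simp
qed

lemma measure_prod_X_eq_1:
  assumes "\<forall>i\<in>{1..n}. \<alpha> i \<le> i" "k \<le> n"
  shows "\<P>(\<omega> in step_space p. (\<Prod>j=1..k. X n \<alpha> j \<omega>) = 1) =
    (\<Prod>j=1..k. hitting_prob p (displacement \<alpha> j) (\<lambda>t. t \<noteq> \<infinity>))"
  unfolding prod_X_eq_1_iff[OF assms] by (simp add: measure_parks_all)

lemma cond_prob_parks:
  assumes \<alpha>: "\<forall>j\<in>{1..n}. \<alpha> j \<le> j" and i: "1 < i" "i \<le> n"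
    and pos: "\<P>(\<omega> in step_space p. (\<Prod>j=1..i-1. X n \<alpha> j \<omega>) = 1) > 0"
  shows "cond_prob (step_space p) (\<lambda>\<omega>. X n \<alpha> i \<omega> = 1) (\<lambda>\<omega>. (\<Prod>j=1..i-1. X n \<alpha> j \<omega>) = 1) =
    hitting_prob p (displacement \<alpha> i) (\<lambda>t. t \<noteq> \<infinity>)"
proof -
  let ?h = "\<lambda>j. hitting_prob p (displacement \<alpha> j) (\<lambda>t. t \<noteq> \<infinity>)"
  have split: "{1..i} = insert i {1..i-1}" using i by auto
  have earlier: "\<P>(\<omega> in step_space p. (\<Prod>j=1..i-1. X n \<alpha> j \<omega>) = 1) = (\<Prod>j=1..i-1. ?h j)"
    by (rule measure_prod_X_eq_1[OF \<alpha>]) (use i in auto)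
  have "{\<omega>. X n \<alpha> i \<omega> = 1 \<and> (\<Prod>j=1..i-1. X n \<alpha> j \<omega>) = 1} = {\<omega>. \<forall>j\<in>{1..i}. parks \<alpha> j \<omega>}"
    using i prod_X_eq_1_iff[OF \<alpha>, of "i - 1"] X_eq[OF \<alpha> i(2)] by (auto split: if_splits)
  then have "\<P>(\<omega> in step_space p. X n \<alpha> i \<omega> = 1 \<and> (\<Prod>j=1..i-1. X n \<alpha> j \<omega>) = 1) = (\<Prod>j=1..i. ?h j)"
    by (simp add: measure_parks_all)
  also have "\<dots> = ?h i * (\<Prod>j=1..i-1. ?h j)"
    using i unfolding split by (subst prod.insert) auto
  finally have both:
    "\<P>(\<omega> in step_space p. X n \<alpha> i \<omega> = 1 \<and> (\<Prod>j=1..i-1. X n \<alpha> j \<omega>) = 1) = ?h i * (\<Prod>j=1..i-1. ?h j)" .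
  show ?thesis
    unfolding cond_prob_def both earlier
    by (rule nonzero_mult_div_cancel_right) (use pos earlier in linarith)
qed

theorem theorem1p4:
  fixes n :: nat and p q :: real and \<alpha> :: "nat \<Rightarrow> nat"
  assumes "0 \<le> p" and "p \<le> 1" and "q = 1 - p"
    and "parking_function n \<alpha>" and "identity_outcome n \<alpha>"
  shows
    "(\<forall>i. 1 < i \<and> i \<le> n \<longrightarrow>
        (let d = displacement \<alpha> i;
             earlier = (\<lambda>\<omega>. (\<Prod>j=1..i-1. X n \<alpha> j \<omega>) = 1);
             P = cond_prob (step_space p) (\<lambda>\<omega>. X n \<alpha> i \<omega> = 1) earlier
         in (d > 0 \<or> \<P>(\<omega> in step_space p. earlier \<omega>) > 0 \<longrightarrow>
               (\<lambda>l. (if l + d = 0 then 1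
                     else real d / real (l + d) * real ((2 * l + d - 1) choose l))
                    * p ^ (d + l) * q ^ l) sums P) \<and>
            (d > 0 \<longrightarrow> (P = 1 \<longleftrightarrow> 1 / 2 \<le> p \<and> p \<le> 1)))) \<and>
     (\<forall>i. 1 < i \<and> i \<le> n \<and> 1 / 2 < p \<and> p \<le> 1 \<longrightarrow>
        cond_expectation (step_space p) (\<lambda>\<omega>. ennreal_of_enat (\<tau> \<alpha> i \<omega>))
            (\<lambda>\<omega>. (\<Prod>j=1..i. X n \<alpha> j \<omega>) = 1)
          = ennreal (real (displacement \<alpha> i) / (p - q)))"
proof (intro conjI allI impI)
  have \<alpha>: "\<forall>j\<in>{1..n}. \<alpha> j \<le> j"
    using identity_outcome_le[OF assms(5)] by blast
  {
    fix i assume i: "1 < i \<and> i \<le> n \<and> 1 / 2 < p \<and> p \<le> 1"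
    have "p - q = 2 * p - 1" using assms(3) by simp
    then show "cond_expectation (step_space p) (\<lambda>\<omega>. ennreal_of_enat (\<tau> \<alpha> i \<omega>))
            (\<lambda>\<omega>. (\<Prod>j=1..i. X n \<alpha> j \<omega>) = 1)
          = ennreal (real (displacement \<alpha> i) / (p - q))"
      using cond_expectation_\<tau>[of n \<alpha> i p] \<alpha> i by simp
  next
    fix i assume i: "1 < i \<and> i \<le> n"
    define d where "d = displacement \<alpha> i"
    define earlier where "earlier = (\<lambda>\<omega>. (\<Prod>j=1..i-1. X n \<alpha> j \<omega>) = 1)"
    define P where "P = cond_prob (step_space p) (\<lambda>\<omega>. X n \<alpha> i \<omega> = 1) earlier"
    let ?h = "\<lambda>d. hitting_prob p d (\<lambda>t. t \<noteq> \<infinity>)"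
    have sums: "(\<lambda>l. first_passage_paths d l * p ^ (d + l) * q ^ l) sums ?h d"
      unfolding assms(3) by (rule first_passage_sums) (use assms in auto)
    have P: "P = ?h d" if nz: "d > 0 \<or> \<P>(\<omega> in step_space p. earlier \<omega>) > 0"
    proof (cases "\<P>(\<omega> in step_space p. earlier \<omega>) > 0")
      case True
      then show ?thesis
        using cond_prob_parks[of n \<alpha> i p] \<alpha> i by (simp add: P_def d_def earlier_def)
    next
      \<comment> \<open>The condition has probability \<open>0\<close>, so \<open>P\<close> is the quotient \<open>0 / 0 = 0\<close>. All passage
        probabilities are positive for \<open>p > 0\<close>, hence \<open>p = 0\<close>, and the series vanishes as \<open>d > 0\<close>.\<close>
      case False
      then have "P = 0" using zero_less_measure_iff[of "step_space p"] by (simp add: P_def cond_prob_def)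
      have "\<P>(\<omega> in step_space p. earlier \<omega>) = (\<Prod>j=1..i-1. ?h (displacement \<alpha> j))"
        unfolding earlier_def by (rule measure_prod_X_eq_1[OF \<alpha>]) (use i in auto)
      with False have "\<not> 0 < p"
        using hitting_prob_finite_pos[of p] assms(2) by (auto intro!: prod_pos)
      then have "p = 0" using assms(1) by simp
      moreover from this have "?h d = 0"
      proof -
        have "(\<lambda>l. first_passage_paths d l * p ^ (d + l) * q ^ l) = (\<lambda>l. 0)"
          using \<open>p = 0\<close> nz False by auto
        then show ?thesis using sums sums_unique2[OF sums_zero] by metis
      qed
      ultimately show ?thesis using \<open>P = 0\<close> by simp
    qed
    have "?h d = 1 \<longleftrightarrow> 1 / 2 \<le> p \<and> p \<le> 1" if "d > 0"
      using hitting_prob_finite_eq_1[of p d] hitting_prob_finite_less_1[of p d] that assms(1,2)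
      by fastforce
    then show "let d = displacement \<alpha> i;
             earlier = (\<lambda>\<omega>. (\<Prod>j=1..i-1. X n \<alpha> j \<omega>) = 1);
             P = cond_prob (step_space p) (\<lambda>\<omega>. X n \<alpha> i \<omega> = 1) earlier
         in (d > 0 \<or> \<P>(\<omega> in step_space p. earlier \<omega>) > 0 \<longrightarrow>
               (\<lambda>l. (if l + d = 0 then 1
                     else real d / real (l + d) * real ((2 * l + d - 1) choose l))
                    * p ^ (d + l) * q ^ l) sums P) \<and>
            (d > 0 \<longrightarrow> (P = 1 \<longleftrightarrow> 1 / 2 \<le> p \<and> p \<le> 1))"
      using P sums unfolding Let_def first_passage_paths_def
        d_def[symmetric] earlier_def[symmetric] P_def[symmetric] by auto
  }
qed

end
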